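(* Let $G$ be a Lie group, $M$ a differentiable manifold endowed with a metric $d$ inducing the topology of $M$, $X$ a non-empty compact subset of $M$, and $\varphi:G\times M\to M$ a smooth left action by isometries of $(M,d)$. Then there exists $\varepsilon>0$ such that for every $gH_X\in G/H_X$ the ball $B_{d_X}(gH_X,\varepsilon)=\{p\in G/H_X: d_X(p,gH_X)<\varepsilon\}$ is contained in a countable (finite or infinite) union $\bigcup_{i\in\Lambda}K_i$ of pairwise disjoint subsets $K_i\subset G/H_X$ that are compact with respect to the quotient topology $\tau$ of $G/H_X$.
   Context: All differentiable manifolds (including Lie groups) are Hausdorff with countable basis. The action is by isometries if $d(gx,gy)=d(x,y)$ for all $g\in G$, $x,y\in M$. $H_X=\{g\in G:gX=X\}$ is the isotropy subgroup of $X$, which is closed in $G$. The induced Hausdorff metric on $G/H_X$ is $d_X(g_1H_X,g_2H_X)=d_H(g_1X,g_2X)$, where $d_H(A,B)=\max\{\sup_{a\in A}d(a,B),\sup_{b\in B}d(b,A)\}$ is the Hausdorff distance. Note that $d_X$ need not induce $\tau$. *)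

theory Defs
  imports "HOL-Analysis.Analysis" "HOL-Algebra.Group_Action" "HOL-Algebra.Left_Coset"
begin

section \<open>Smooth maps between Euclidean spaces\<close>

text \<open>
  \<open>\<real>\<close>-valued functions on a subset \<open>W\<close> of \<open>Euclidean_space n\<close> (sequences vanishing from index \<open>n\<close>
  on); \<open>\<lambda>t. f (x(i := t))\<close> is the restriction of \<open>f\<close> to the \<open>i\<close>-th coordinate line through \<open>x\<close>.
  The notion is only used for open \<open>W\<close>, where the derivatives do not depend on values outside \<open>W\<close>.
  The explicit dimension \<open>n\<close> may be \<open>0\<close>, so that discrete groups are Lie groups.
\<close>

fun Ck_on :: "nat \<Rightarrow> nat \<Rightarrow> (nat \<Rightarrow> real) set \<Rightarrow> ((nat \<Rightarrow> real) \<Rightarrow> real) \<Rightarrow> bool" where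
  "Ck_on n 0 W f \<longleftrightarrow> continuous_map (subtopology (Euclidean_space n) W) euclideanreal f"
| "Ck_on n (Suc k) W f \<longleftrightarrow>
     continuous_map (subtopology (Euclidean_space n) W) euclideanreal f \<and>
     (\<forall>i<n. (\<forall>x\<in>W. (\<lambda>t. f (x(i := t))) differentiable (at (x i))) \<and>
            Ck_on n k W (\<lambda>x. deriv (\<lambda>t. f (x(i := t))) (x i)))"

definition smooth_on ::
  "nat \<Rightarrow> nat \<Rightarrow> (nat \<Rightarrow> real) set \<Rightarrow> ((nat \<Rightarrow> real) \<Rightarrow> nat \<Rightarrow> real) \<Rightarrow> bool" where
  "smooth_on m n W F \<longleftrightarrow> (\<forall>j<n. \<forall>k. Ck_on m k W (\<lambda>x. F x j))"


section \<open>Smooth manifolds and Lie groups\<close>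

type_synonym 'a chart = "'a set \<times> ('a \<Rightarrow> nat \<Rightarrow> real)"

definition chart_of :: "nat \<Rightarrow> 'a topology \<Rightarrow> 'a chart \<Rightarrow> bool" where
  "chart_of n T = (\<lambda>(U, c).
     openin T U \<and> openin (Euclidean_space n) (c ` U) \<and>
     homeomorphic_map (subtopology T U) (subtopology (Euclidean_space n) (c ` U)) c)"

text \<open>
  The smooth structure is given by an atlas \<open>A\<close>, not required to be maximal. Smooth
  compatibility is imposed on all ordered pairs of charts, hence covers the inverse transitions.
\<close>

locale smooth_manifold =
  fixes n :: nat and T :: "'a topology" and A :: "'a chart set"
  assumes Hausdorff: "Hausdorff_space T"
    and second_countable: "second_countable T"
    and charts: "\<And>C. C \<in> A \<Longrightarrow> chart_of n T C"
    and cover: "(\<Union>(U, c)\<in>A. U) = topspace T"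
    and compatible: "\<And>U c V c'. \<lbrakk>(U, c) \<in> A; (V, c') \<in> A\<rbrakk> \<Longrightarrow>
                       smooth_on n n (c ` (U \<inter> V)) (\<lambda>x. c' (inv_into U c x))"

definition smooth_map ::
  "nat \<Rightarrow> 'a topology \<Rightarrow> 'a chart set \<Rightarrow> nat \<Rightarrow> 'b topology \<Rightarrow> 'b chart set \<Rightarrow> ('a \<Rightarrow> 'b) \<Rightarrow> bool" where
  "smooth_map m S A n T B f \<longleftrightarrow>
     continuous_map S T f \<and>
     (\<forall>(U, c)\<in>A. \<forall>(V, c')\<in>B.
        smooth_on m n (c ` (U \<inter> f -` V)) (\<lambda>x. c' (f (inv_into U c x))))"

text \<open>Concatenation of coordinates, identifying \<open>\<real>\<^sup>m \<times> \<real>\<^sup>n\<close> with \<open>\<real>\<^sup>m\<^sup>+\<^sup>n\<close>.\<close>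

definition join_coords :: "nat \<Rightarrow> (nat \<Rightarrow> real) \<Rightarrow> (nat \<Rightarrow> real) \<Rightarrow> nat \<Rightarrow> real" where
  "join_coords m x y = (\<lambda>i. if i < m then x i else y (i - m))"

text \<open>Atlas of the product manifold; the dimension of its first factor is \<open>m\<close>.\<close>

definition prod_atlas :: "nat \<Rightarrow> 'a chart set \<Rightarrow> 'b chart set \<Rightarrow> ('a \<times> 'b) chart set" where
  "prod_atlas m A B =
     (\<lambda>((U, c), (V, c')). (U \<times> V, \<lambda>(p, q). join_coords m (c p) (c' q))) ` (A \<times> B)"

locale lie_group = group G + smooth_manifold m T A
  for G :: "('g, 'r) monoid_scheme" (structure)
    and m :: nat and T :: "'g topology" and A :: "'g chart set" +
  assumes carrier_eq: "carrier G = topspace T"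
    and smooth_mult:
      "smooth_map (m + m) (prod_topology T T) (prod_atlas m A A) m T A (\<lambda>(g, h). g \<otimes> h)"
    and smooth_inv: "smooth_map m T A m T A (\<lambda>g. inv g)"


section \<open>Isotropy group, coset space and the induced Hausdorff metric\<close>

definition isotropy :: "('g, 'r) monoid_scheme \<Rightarrow> ('g \<Rightarrow> 'a \<Rightarrow> 'a) \<Rightarrow> 'a set \<Rightarrow> 'g set" where
  "isotropy G \<Phi> X = {g \<in> carrier G. \<Phi> g ` X = X}"

text \<open>The quotient topology on the left cosets; see \<open>quotient_map_coset_topology\<close> below.\<close>

definition coset_topology ::
  "('g, 'r) monoid_scheme \<Rightarrow> 'g topology \<Rightarrow> 'g set \<Rightarrow> 'g set topology" where
  "coset_topology G T H =
     topology (\<lambda>U. U \<subseteq> lcosets\<^bsub>G\<^esub> H \<and> openin T {g \<in> carrier G. g <#\<^bsub>G\<^esub> H \<in> U})"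

text \<open>Only meaningful for non-empty bounded sets, where all suprema and infima exist.\<close>

definition hausdorff_dist :: "('a \<Rightarrow> 'a \<Rightarrow> real) \<Rightarrow> 'a set \<Rightarrow> 'a set \<Rightarrow> real" where
  "hausdorff_dist d A B =
     max (SUP a\<in>A. INF b\<in>B. d a b) (SUP b\<in>B. INF a\<in>A. d b a)"

text \<open>
  The value does not depend on the representatives of the cosets; see \<open>induced_dist_lcoset\<close> below.
\<close>

definition induced_dist ::
  "('a \<Rightarrow> 'a \<Rightarrow> real) \<Rightarrow> ('g \<Rightarrow> 'a \<Rightarrow> 'a) \<Rightarrow> 'a set \<Rightarrow> 'g set \<Rightarrow> 'g set \<Rightarrow> real" where
  "induced_dist d \<Phi> X C\<^sub>1 C\<^sub>2 =
     (THE r. \<forall>g\<^sub>1\<in>C\<^sub>1. \<forall>g\<^sub>2\<in>C\<^sub>2. r = hausdorff_dist d (\<Phi> g\<^sub>1 ` X) (\<Phi> g\<^sub>2 ` X))"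

lemma openin_coset_topology:
  "openin (coset_topology G T H) U \<longleftrightarrow>
     U \<subseteq> lcosets\<^bsub>G\<^esub> H \<and> openin T {g \<in> carrier G. g <#\<^bsub>G\<^esub> H \<in> U}"
proof -
  let ?P = "\<lambda>U. U \<subseteq> lcosets\<^bsub>G\<^esub> H \<and> openin T {g \<in> carrier G. g <#\<^bsub>G\<^esub> H \<in> U}"
  have "istopology ?P"
    unfolding istopology_def
  proof (intro conjI allI impI)
    fix U V assume "?P U" "?P V"
    moreover have "{g \<in> carrier G. g <#\<^bsub>G\<^esub> H \<in> U \<inter> V} =
        {g \<in> carrier G. g <#\<^bsub>G\<^esub> H \<in> U} \<inter> {g \<in> carrier G. g <#\<^bsub>G\<^esub> H \<in> V}" by auto
    ultimately show "U \<inter> V \<subseteq> lcosets\<^bsub>G\<^esub> H" "openin T {g \<in> carrier G. g <#\<^bsub>G\<^esub> H \<in> U \<inter> V}"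
      by (auto intro: openin_Int)
  next
    fix \<K> assume *: "\<forall>K\<in>\<K>. ?P K"
    have "{g \<in> carrier G. g <#\<^bsub>G\<^esub> H \<in> \<Union>\<K>} = (\<Union>K\<in>\<K>. {g \<in> carrier G. g <#\<^bsub>G\<^esub> H \<in> K})"
      by auto
    then show "\<Union>\<K> \<subseteq> lcosets\<^bsub>G\<^esub> H" "openin T {g \<in> carrier G. g <#\<^bsub>G\<^esub> H \<in> \<Union>\<K>}"
      using * by auto
  qed
  then show ?thesis
    by (simp add: coset_topology_def topology_inverse')
qed

lemma topspace_coset_topology:
  assumes "carrier G = topspace T"
  shows "topspace (coset_topology G T H) = lcosets\<^bsub>G\<^esub> H"
proof -
  have "{g \<in> carrier G. g <#\<^bsub>G\<^esub> H \<in> lcosets\<^bsub>G\<^esub> H} = topspace T"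
    using assms by (auto simp: LCOSETS_def)
  then have "openin (coset_topology G T H) (lcosets\<^bsub>G\<^esub> H)"
    by (simp add: openin_coset_topology)
  then show ?thesis
    by (meson openin_coset_topology openin_subset openin_topspace subset_antisym)
qed

lemma quotient_map_coset_topology:
  assumes "carrier G = topspace T"
  shows "quotient_map T (coset_topology G T H) (\<lambda>g. g <#\<^bsub>G\<^esub> H)"
  using assms
  by (auto simp: quotient_map_def topspace_coset_topology openin_coset_topology LCOSETS_def)

context group_action
begin

lemma image_mult:
  assumes "g \<in> carrier G" "h \<in> carrier G" "X \<subseteq> E"
  shows "\<phi> (g \<otimes> h) ` X = \<phi> g ` \<phi> h ` X"
  using assms composition_rule by (force simp: image_iff)

lemma subgroup_isotropy:
  assumes "X \<subseteq> E"
  shows "subgroup (isotropy G \<phi> X) G"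
proof -
  interpret group G using group_hom group_hom.axioms(1) by blast
  have one: "\<phi> \<one> ` X = X"
    using assms by (force simp: id_eq_one[symmetric])
  show ?thesis
  proof
    show "isotropy G \<phi> X \<subseteq> carrier G" "\<one> \<in> isotropy G \<phi> X"
      using one by (auto simp: isotropy_def)
  next
    fix g h assume "g \<in> isotropy G \<phi> X" "h \<in> isotropy G \<phi> X"
    then show "g \<otimes> h \<in> isotropy G \<phi> X"
      using assms by (simp add: isotropy_def image_mult)
  next
    fix g assume g: "g \<in> isotropy G \<phi> X"
    then have "\<phi> (inv g) ` X = \<phi> (inv g) ` \<phi> g ` X"
      by (simp add: isotropy_def)
    also have "\<dots> = \<phi> (inv g \<otimes> g) ` X"
      using image_mult[of "inv g" g X] g assms by (simp add: isotropy_def)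
    finally show "inv g \<in> isotropy G \<phi> X"
      using g one by (simp add: isotropy_def)
  qed
qed

lemma induced_dist_lcoset:
  assumes "X \<subseteq> E" and g: "g\<^sub>1 \<in> carrier G" "g\<^sub>2 \<in> carrier G"
  shows "induced_dist d \<phi> X (g\<^sub>1 <# isotropy G \<phi> X) (g\<^sub>2 <# isotropy G \<phi> X) =
         hausdorff_dist d (\<phi> g\<^sub>1 ` X) (\<phi> g\<^sub>2 ` X)"
proof -
  let ?H = "isotropy G \<phi> X"
  interpret group G using group_hom group_hom.axioms(1) by blast
  have eq: "\<phi> k ` X = \<phi> g ` X" if gk: "g \<in> carrier G" "k \<in> g <# ?H" for g k
  proof -
    obtain h where "h \<in> carrier G" "\<phi> h ` X = X" "k = g \<otimes> h"
      using gk(2) by (auto simp: l_coset_def isotropy_def)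
    then show ?thesis
      using image_mult[of g h X] gk(1) assms(1) by simp
  qed
  have mem: "g \<in> g <# ?H" if "g \<in> carrier G" for g
    using that subgroup.one_closed[OF subgroup_isotropy[OF assms(1)]]
    by (force simp: l_coset_def)
  show ?thesis
    unfolding induced_dist_def
  proof (rule the_equality)
    show "\<forall>k\<^sub>1\<in>g\<^sub>1 <# ?H. \<forall>k\<^sub>2\<in>g\<^sub>2 <# ?H.
        hausdorff_dist d (\<phi> g\<^sub>1 ` X) (\<phi> g\<^sub>2 ` X) = hausdorff_dist d (\<phi> k\<^sub>1 ` X) (\<phi> k\<^sub>2 ` X)"
      using eq g by metis
  qed (use mem g in blast)
qed

end

end

theory Submission
  imports Defs
begin

text \<open>
  Write \<open>D g h = d\<^sub>H(gX, hX)\<close>, a continuous left-invariant pseudometric on \<open>G\<close>, and \<open>H = H\<^sub>X\<close>. Let \<open>V\<close>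
  be an open neighbourhood of the identity inside a compact set \<open>C\<close>. As \<open>D(\<cdot>, 1)\<close> vanishes only on \<open>H\<close>,
  it is at least some \<open>\<delta> > 0\<close> on the compact set \<open>C - VH\<close>. Put \<open>\<epsilon> = \<delta>/3\<close> and let \<open>S\<close> be a closed
  \<open>D\<close>-ball of radius \<open>\<epsilon>\<close>. By the triangle inequality \<open>S \<inter> gCH \<subseteq> gVH\<close> for every \<open>g \<in> S\<close>, so these sets
  are relatively clopen in \<open>S\<close>. Countably many \<open>g\<^sub>iV\<close> with \<open>g\<^sub>i \<in> S\<close> cover \<open>S\<close>, and the images in \<open>G/H\<close>
  of the compact sets \<open>S \<inter> g\<^sub>iC - (\<Union>j<i. g\<^sub>jVH)\<close> are pairwise disjoint and cover the ball.
\<close>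

section \<open>Hausdorff distance of non-empty compact sets\<close>

context Metric_space
begin

text \<open>Compactness of the second set makes each infimum attained, and boundedness of the first
  makes the supremum well behaved. All later arguments about the distance work with these
  quantifiers instead of suprema and infima.\<close>

lemma hausdorff_dist_le_iff:
  assumes A: "compactin mtopology A" "A \<noteq> {}" and B: "compactin mtopology B" "B \<noteq> {}"
  shows "hausdorff_dist d A B \<le> r \<longleftrightarrow>
    (\<forall>a\<in>A. \<exists>b\<in>B. d a b \<le> r) \<and> (\<forall>b\<in>B. \<exists>a\<in>A. d b a \<le> r)"
proof -
  \<comment> \<open>Stated for arbitrary \<open>A\<close> and \<open>B\<close>, so that exchanging
    them yields the other half of the \<open>max\<close>.\<close>
  have sup: "(SUP a\<in>A. INF b\<in>B. d a b) \<le> r \<longleftrightarrow> (\<forall>a\<in>A. \<exists>b\<in>B. d a b \<le> r)"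
    if A: "compactin mtopology A" "A \<noteq> {}" and B: "compactin mtopology B" "B \<noteq> {}" for A B
  proof -
    have sub: "A \<subseteq> M" "B \<subseteq> M"
      using A(1) B(1) compactin_subset_topspace by fastforce+
    have bdd: "bdd_below (d a ` B)" for a
      by (rule bdd_belowI[of _ 0]) auto
    have inf: "(INF b\<in>B. d a b) \<le> r \<longleftrightarrow> (\<exists>b\<in>B. d a b \<le> r)" if "a \<in> A" for a
    proof
      have "a \<in> M"
        using that sub by blast
      then have "continuous_map mtopology euclideanreal (d a)"
        using continuous_map_mdist[of mtopology "metric (M, d)" "\<lambda>_. a" "\<lambda>b. b"] by simp
      then have "compact (d a ` B)"
        using B(1) image_compactin by fastforce
      then obtain b where b: "b \<in> B" "\<And>b'. b' \<in> B \<Longrightarrow> d a b \<le> d a b'"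
        using B(2) compact_attains_inf[of "d a ` B"] by blast
      then have "d a b \<le> (INF b\<in>B. d a b)"
        using B(2) by (intro cINF_greatest)
      then show "\<exists>b\<in>B. d a b \<le> r" if "(INF b\<in>B. d a b) \<le> r"
        using b(1) that by force
      show "(INF b\<in>B. d a b) \<le> r" if "\<exists>b\<in>B. d a b \<le> r"
        using that bdd cINF_lower2 by metis
    qed
    obtain b0 where b0: "b0 \<in> B"
      using B(2) by blast
    \<comment> \<open>The distances to one fixed \<open>b0\<close> dominate all the infima, so the
      supremum is taken over a set bounded above.\<close>
    have "mbounded (insert b0 A)"
      using A(1) b0 sub compactin_imp_mbounded mbounded_insert by blast
    then obtain R where R: "\<And>a. a \<in> A \<Longrightarrow> d a b0 \<le> R"
      unfolding mbounded_alt by blast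
    have "bdd_above ((\<lambda>a. INF b\<in>B. d a b) ` A)"
      using R b0 bdd by (intro bdd_aboveI[of _ R]) (auto intro: cINF_lower2)
    then have "(SUP a\<in>A. INF b\<in>B. d a b) \<le> r \<longleftrightarrow> (\<forall>a\<in>A. (INF b\<in>B. d a b) \<le> r)"
      using A(2) by (rule cSUP_le_iff[rotated])
    then show ?thesis
      using inf by simp
  qed
  show ?thesis
    unfolding hausdorff_dist_def using sup[OF A B] sup[OF B A] by auto
qed

text \<open>Chains nearby points through \<open>B\<close>, once from \<open>A\<close> to
  \<open>C\<close> and once from \<open>C\<close> to \<open>A\<close>.\<close>

lemma hausdorff_dist_triangle:
  assumes A: "compactin mtopology A" "A \<noteq> {}" and B: "compactin mtopology B" "B \<noteq> {}"
    and C: "compactin mtopology C" "C \<noteq> {}"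
  shows "hausdorff_dist d A C \<le> hausdorff_dist d A B + hausdorff_dist d B C"
proof -
  have sub: "A \<subseteq> M" "B \<subseteq> M" "C \<subseteq> M"
    using assms compactin_subset_topspace by fastforce+
  have tri: "\<exists>c\<in>C. d a c \<le> r + s"
    if AB: "\<forall>a\<in>A. \<exists>b\<in>B. d a b \<le> r" and BC: "\<forall>b\<in>B. \<exists>c\<in>C. d b c \<le> s" and "a \<in> A"
      and sub: "A \<subseteq> M" "B \<subseteq> M" "C \<subseteq> M" for A B C a r s
  proof -
    obtain b c where bc: "b \<in> B" "d a b \<le> r" "c \<in> C" "d b c \<le> s"
      using \<open>a \<in> A\<close> AB BC by metis
    then have "a \<in> M" "b \<in> M" "c \<in> M"
      using \<open>a \<in> A\<close> sub by auto
    then show ?thesis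
      using triangle[of a b c] bc by force
  qed
  define r s where "r = hausdorff_dist d A B" and "s = hausdorff_dist d B C"
  have AB: "\<forall>a\<in>A. \<exists>b\<in>B. d a b \<le> r" "\<forall>b\<in>B. \<exists>a\<in>A. d b a \<le> r"
    using hausdorff_dist_le_iff[OF A B, of r] by (auto simp: r_def)
  have BC: "\<forall>b\<in>B. \<exists>c\<in>C. d b c \<le> s" "\<forall>c\<in>C. \<exists>b\<in>B. d c b \<le> s"
    using hausdorff_dist_le_iff[OF B C, of s] by (auto simp: s_def)
  have "hausdorff_dist d A C \<le> r + s"
    unfolding hausdorff_dist_le_iff[OF A C]
    using tri[OF AB(1) BC(1)] tri[OF BC(2) AB(2)] sub by (simp add: add.commute)
  then show ?thesis
    by (simp add: r_def s_def)
qed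

lemma hausdorff_dist_le_0_iff:
  assumes A: "compactin mtopology A" "A \<noteq> {}" and B: "compactin mtopology B" "B \<noteq> {}"
  shows "hausdorff_dist d A B \<le> 0 \<longleftrightarrow> A = B"
proof -
  have sub: "A \<subseteq> M" "B \<subseteq> M"
    using assms compactin_subset_topspace by fastforce+
  have "d a b \<le> 0 \<longleftrightarrow> a = b" if "a \<in> M" "b \<in> M" for a b
    using that by (metis nonneg order_antisym_conv zero order_refl)
  then show ?thesis
    unfolding hausdorff_dist_le_iff[OF assms] using sub by (metis subsetD subsetI subset_antisym)
qed

text \<open>By compactness of \<open>X\<close>, group elements near \<open>g\<close> move all points
  of \<open>X\<close> uniformly close to their images under \<open>g\<close>; the triangle
  inequality then compares the distances to \<open>B\<close>.\<close>

lemma continuous_map_hausdorff_dist: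
  assumes cont: "continuous_map (prod_topology T mtopology) mtopology (\<lambda>(g, x). \<phi> g x)"
    and X: "compactin mtopology X" "X \<noteq> {}" and B: "compactin mtopology B" "B \<noteq> {}"
  shows "continuous_map T euclideanreal (\<lambda>g. hausdorff_dist d (\<phi> g ` X) B)"
proof -
  have XM: "X \<subseteq> M"
    using X(1) compactin_subset_topspace by fastforce
  have closed: "\<phi> g x \<in> M" if "g \<in> topspace T" "x \<in> M" for g x
    using continuous_map_image_subset_topspace[OF cont] that by force
  have slice: "continuous_map mtopology mtopology (\<phi> g)" if "g \<in> topspace T" for g
    using continuous_map_compose[OF _ cont, of mtopology "\<lambda>x. (g, x)"] that
    by (auto simp: o_def continuous_map_pairwise)
  have cpt: "compactin mtopology (\<phi> g ` X)" "\<phi> g ` X \<noteq> {}" if "g \<in> topspace T" for g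
    using image_compactin[OF X(1) slice[OF that]] X(2) by auto
  have near: "\<exists>U. openin T U \<and> g \<in> U \<and>
      (\<forall>h\<in>U. \<bar>hausdorff_dist d (\<phi> h ` X) B - hausdorff_dist d (\<phi> g ` X) B\<bar> \<le> e)"
    if g: "g \<in> topspace T" and "e > 0" for g e
  proof -
    \<comment> \<open>\<open>f\<close> vanishes on \<open>{g} \<times> X\<close>, so the tube lemma
      gives one neighbourhood \<open>U\<close> of \<open>g\<close> on which it stays below
      \<open>e\<close> for every \<open>x \<in> X\<close>.\<close>
    define f where "f = (\<lambda>(h, x). d (\<phi> h x) (\<phi> g x))"
    have "continuous_map (prod_topology T mtopology) mtopology (\<lambda>p. \<phi> g (snd p))"
      using continuous_map_compose[OF continuous_map_snd slice[OF g], of T] by (simp add: o_def)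
    then have "continuous_map (prod_topology T mtopology) euclideanreal f"
      using continuous_map_mdist[of "prod_topology T mtopology" "metric (M, d)"
          "\<lambda>(g, x). \<phi> g x" "\<lambda>p. \<phi> g (snd p)"] cont
      by (simp add: f_def case_prod_unfold)
    then have "openin (prod_topology T mtopology) {p \<in> topspace (prod_topology T mtopology). f p \<in> {..<e}}"
      (is "openin _ ?W") by (rule openin_continuous_map_preimage) auto
    moreover have "{g} \<times> X \<subseteq> ?W"
      using g XM closed \<open>e > 0\<close> by (auto simp: f_def subset_iff)
    ultimately have "\<exists>U V. openin T U \<and> openin mtopology V \<and> g \<in> U \<and> X \<subseteq> V \<and> U \<times> V \<subseteq> ?W"
      by (intro tube_lemma_right X(1) g)
    then obtain U V where UV: "openin T U" "X \<subseteq> V" "g \<in> U" "U \<times> V \<subseteq> ?W"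
      by blast
    have "\<bar>hausdorff_dist d (\<phi> h ` X) B - hausdorff_dist d (\<phi> g ` X) B\<bar> \<le> e" if "h \<in> U" for h
    proof -
      have h: "h \<in> topspace T"
        using that UV(1) openin_subset by blast
      have "d (\<phi> h x) (\<phi> g x) \<le> e" if "x \<in> X" for x
        using UV(2,4) that \<open>h \<in> U\<close> by (force simp: f_def)
      then have "hausdorff_dist d (\<phi> h ` X) (\<phi> g ` X) \<le> e" "hausdorff_dist d (\<phi> g ` X) (\<phi> h ` X) \<le> e"
        unfolding hausdorff_dist_le_iff[OF cpt[OF h] cpt[OF g]] hausdorff_dist_le_iff[OF cpt[OF g] cpt[OF h]]
        by (auto simp: commute)
      then show ?thesis
        using hausdorff_dist_triangle[OF cpt[OF h] cpt[OF g] B]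
          hausdorff_dist_triangle[OF cpt[OF g] cpt[OF h] B] by linarith
    qed
    then show ?thesis
      using UV by blast
  qed
  have "\<exists>U. openin T U \<and> g \<in> U \<and>
      (\<forall>h\<in>U. hausdorff_dist d (\<phi> h ` X) B \<in> Met_TC.mball (hausdorff_dist d (\<phi> g ` X) B) e)"
    if g: "g \<in> topspace T" "e > 0" for g e
  proof -
    \<comment> \<open>Half of \<open>e\<close> turns the non-strict bound of \<open>near\<close>
      into membership in the open ball.\<close>
    obtain U where U: "openin T U" "g \<in> U"
        "\<forall>h\<in>U. \<bar>hausdorff_dist d (\<phi> h ` X) B - hausdorff_dist d (\<phi> g ` X) B\<bar> \<le> e / 2"
      using near[OF g(1), of "e / 2"] g(2) by auto
    have "hausdorff_dist d (\<phi> h ` X) B \<in> Met_TC.mball (hausdorff_dist d (\<phi> g ` X) B) e"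
      if "h \<in> U" for h
      using bspec[OF U(3) that] g(2) by (simp add: dist_real_def abs_minus_commute)
    then show ?thesis
      using U(1,2) by blast
  qed
  then have "continuous_map T Met_TC.mtopology (\<lambda>g. hausdorff_dist d (\<phi> g ` X) B)"
    unfolding Met_TC.continuous_map_to_metric by blast
  then show ?thesis
    by simp
qed

end

section \<open>Local compactness and translations of open sets\<close>

text \<open>Each chart domain is homeomorphic to an open subset of Euclidean space. Being open in
  \<open>T\<close>, it passes its compact neighbourhoods on to \<open>T\<close>.\<close>

lemma (in smooth_manifold) locally_compact_space: "locally_compact_space T"
  unfolding locally_compact_space_def
proof
  fix x assume "x \<in> topspace T"
  then obtain U c where Uc: "(U, c) \<in> A" "x \<in> U"
    using cover by blast
  then have ch: "openin T U" "openin (Euclidean_space n) (c ` U)"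
      "homeomorphic_map (subtopology T U) (subtopology (Euclidean_space n) (c ` U)) c"
    using charts[OF Uc(1)] by (auto simp: chart_of_def)
  have "locally_compact_space (subtopology (Euclidean_space n) (c ` U))"
    using ch(2) by (intro locally_compact_space_open_subset)
      (auto simp: locally_compact_Euclidean_space Hausdorff_Euclidean_space)
  then have "locally_compact_space (subtopology T U)"
    using ch(3) homeomorphic_locally_compact_space homeomorphic_space by blast
  moreover have "x \<in> topspace (subtopology T U)"
    using \<open>x \<in> topspace T\<close> \<open>x \<in> U\<close> by simp
  ultimately obtain V K where "openin (subtopology T U) V" "compactin (subtopology T U) K" "x \<in> V" "V \<subseteq> K"
    unfolding locally_compact_space_def by blast
  then show "\<exists>V K. openin T V \<and> compactin T K \<and> x \<in> V \<and> V \<subseteq> K"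
    using ch(1) by (meson compactin_subtopology openin_trans_full)
qed

lemma (in lie_group) continuous_map_mult:
  "continuous_map (prod_topology T T) T (\<lambda>(g, h). g \<otimes> h)"
  using smooth_mult by (simp add: smooth_map_def)

lemma (in lie_group) continuous_map_left_translation:
  assumes "g \<in> carrier G"
  shows "continuous_map T T (\<lambda>h. g \<otimes> h)"
  using continuous_map_compose[OF _ continuous_map_mult, of T "\<lambda>h. (g, h)"] assms
  by (auto simp: o_def continuous_map_pairwise carrier_eq)

lemma (in lie_group) continuous_map_right_translation:
  assumes "g \<in> carrier G"
  shows "continuous_map T T (\<lambda>h. h \<otimes> g)"
  using continuous_map_compose[OF _ continuous_map_mult, of T "\<lambda>h. (h, g)"] assms
  by (auto simp: o_def continuous_map_pairwise carrier_eq)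

lemma (in lie_group) openin_left_translation:
  assumes "g \<in> carrier G" "openin T V"
  shows "openin T ((\<lambda>h. g \<otimes> h) ` V)"
proof -
  have V: "V \<subseteq> carrier G"
    using assms(2) openin_subset carrier_eq by blast
  \<comment> \<open>Image under a translation is preimage under the inverse translation, so
    continuity suffices for openness.\<close>
  have "(\<lambda>h. g \<otimes> h) ` V = {x \<in> topspace T. inv g \<otimes> x \<in> V}"
  proof (intro equalityI subsetI)
    fix x assume x: "x \<in> {x \<in> topspace T. inv g \<otimes> x \<in> V}"
    then have "x = g \<otimes> (inv g \<otimes> x)"
      using assms(1) by (simp add: carrier_eq[symmetric] m_assoc[symmetric])
    then show "x \<in> (\<lambda>h. g \<otimes> h) ` V"
      using x by blast
  qed (use V assms(1) in \<open>auto simp: carrier_eq[symmetric] m_assoc[symmetric] subset_iff\<close>)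
  then show ?thesis
    using openin_continuous_map_preimage[OF continuous_map_left_translation assms(2), of "inv g"]
      assms(1) by simp
qed

lemma (in lie_group) openin_right_translation:
  assumes "g \<in> carrier G" "openin T V"
  shows "openin T ((\<lambda>h. h \<otimes> g) ` V)"
proof -
  have V: "V \<subseteq> carrier G"
    using assms(2) openin_subset carrier_eq by blast
  have "(\<lambda>h. h \<otimes> g) ` V = {x \<in> topspace T. x \<otimes> inv g \<in> V}"
  proof (intro equalityI subsetI)
    fix x assume x: "x \<in> {x \<in> topspace T. x \<otimes> inv g \<in> V}"
    then have "x = (x \<otimes> inv g) \<otimes> g"
      using assms(1) by (simp add: carrier_eq[symmetric] m_assoc)
    then show "x \<in> (\<lambda>h. h \<otimes> g) ` V"
      using x by blast
  qed (use V assms(1) in \<open>auto simp: carrier_eq[symmetric] m_assoc subset_iff\<close>)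
  then show ?thesis
    using openin_continuous_map_preimage[OF continuous_map_right_translation assms(2), of "inv g"]
      assms(1) by simp
qed

lemma (in lie_group) openin_set_mult:
  assumes "openin T V" "S \<subseteq> carrier G"
  shows "openin T (V <#> S)"
proof -
  have "V <#> S = (\<Union>h\<in>S. (\<lambda>v. v \<otimes> h) ` V)"
    by (auto simp: set_mult_def)
  then show ?thesis
    using openin_right_translation assms by (metis (no_types, lifting) imageE openin_Union subsetD)
qed

section \<open>Disjoint compact covers of balls for a left-invariant pseudometric\<close>

text \<open>Isolates what the argument uses of the Hausdorff distance: a continuous left-invariant
  pseudometric on \<open>G\<close> whose zero set at \<open>\<one>\<close> is \<open>H\<close>.
  Closed balls are covered, which leaves room for the open balls of the theorem.\<close>

lemma (in lie_group) coset_balls_in_disjoint_compacts: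
  fixes D :: "'g \<Rightarrow> 'g \<Rightarrow> real"
  assumes H: "subgroup H G"
    and D_eq_0: "\<And>g. g \<in> carrier G \<Longrightarrow> D g \<one> \<le> 0 \<longleftrightarrow> g \<in> H"
    and D_sym: "\<And>g h. D g h = D h g"
    and D_tri: "\<And>g h k. \<lbrakk>g \<in> carrier G; h \<in> carrier G; k \<in> carrier G\<rbrakk> \<Longrightarrow> D g k \<le> D g h + D h k"
    and D_left: "\<And>g h k. \<lbrakk>g \<in> carrier G; h \<in> carrier G; k \<in> carrier G\<rbrakk> \<Longrightarrow> D (g \<otimes> h) (g \<otimes> k) = D h k"
    and D_cont: "\<And>g. g \<in> carrier G \<Longrightarrow> continuous_map T euclideanreal (\<lambda>h. D h g)"
  obtains \<epsilon> where "\<epsilon> > 0"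
    "\<And>g. g \<in> carrier G \<Longrightarrow> \<exists>(\<Lambda> :: nat set) K. disjoint_family_on K \<Lambda> \<and>
       (\<forall>i\<in>\<Lambda>. K i \<subseteq> lcosets H \<and> compactin (coset_topology G T H) (K i)) \<and>
       (\<lambda>k. k <# H) ` {k \<in> carrier G. D k g \<le> \<epsilon>} \<subseteq> (\<Union>i\<in>\<Lambda>. K i)"
proof -
  interpret H: subgroup H G by fact
  obtain V C where V: "openin T V" "\<one> \<in> V" and C: "compactin T C" and "V \<subseteq> C"
    using locally_compact_space one_closed unfolding locally_compact_space_def carrier_eq by meson
  have CG: "C \<subseteq> carrier G"
    using C compactin_subset_topspace carrier_eq by blast
  with \<open>V \<subseteq> C\<close> have VG: "V \<subseteq> carrier G" by blast
  have VH: "openin T (V <#> H)"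
    using openin_set_mult V(1) H.subset by blast
  have H_VH: "H \<subseteq> V <#> H"
    using V(2) H.subset by (force simp: set_mult_def)
  \<comment> \<open>By left invariance \<open>D (k \<otimes> h) k = D h \<one> \<le> 0\<close>. One
    inequality is enough to make balls unions of left cosets of \<open>H\<close>.\<close>
  have D_H: "D (k \<otimes> h) g \<le> D k g" if "k \<in> carrier G" "g \<in> carrier G" "h \<in> H" for g h k
  proof -
    have hG: "h \<in> carrier G" using that(3) H.subset by blast
    have "D (k \<otimes> h) k = D h \<one>"
      using D_left[of k h \<one>] that hG by simp
    then show ?thesis
      using D_tri[of "k \<otimes> h" k g] D_eq_0[of h] that hG by simp
  qed
  obtain \<delta> where \<delta>: "\<delta> > 0" "\<And>c. c \<in> C - (V <#> H) \<Longrightarrow> \<delta> \<le> D c \<one>"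
  proof (cases "C - (V <#> H) = {}")
    \<comment> \<open>With nothing to separate from \<open>H\<close>, any positive value serves as
      \<open>\<delta>\<close>.\<close>
    case True
    then show ?thesis by (intro that[of 1]) auto
  next
    case False
    have "compactin T ((topspace T - (V <#> H)) \<inter> C)"
      using VH C by (intro closed_Int_compactin) auto
    moreover have "(topspace T - (V <#> H)) \<inter> C = C - (V <#> H)"
      using CG carrier_eq by blast
    ultimately have "compact ((\<lambda>c. D c \<one>) ` (C - (V <#> H)))"
      using image_compactin[OF _ D_cont[of \<one>]] by fastforce
    then obtain c where c: "c \<in> C - (V <#> H)" "\<And>c'. c' \<in> C - (V <#> H) \<Longrightarrow> D c \<one> \<le> D c' \<one>"
      using False compact_attains_inf[of "(\<lambda>c. D c \<one>) ` (C - (V <#> H))"] by blast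
    \<comment> \<open>The minimum is attained outside \<open>V <#> H\<close>, hence outside
      \<open>H\<close>, where \<open>D\<close> to \<open>\<one>\<close> is positive.\<close>
    then have "D c \<one> > 0"
      using D_eq_0[of c] CG H_VH by force
    then show ?thesis using that[of "D c \<one>"] c by blast
  qed
  show thesis
  proof (rule that)
    show "\<delta> / 3 > 0" using \<delta>(1) by simp
    fix g0 assume g0: "g0 \<in> carrier G"
    define S where "S = {g \<in> carrier G. D g g0 \<le> \<delta> / 3}"
    have S_H: "s \<otimes> h \<in> S" if "s \<in> S" "h \<in> H" for s h
      using that D_H[of s g0 h] g0 H.subset by (auto simp: S_def)
    define tr where "tr B g = (\<lambda>b. g \<otimes> b) ` B" for B g
    \<comment> \<open>Dropping \<open>h\<close> keeps \<open>g \<otimes> c\<close> in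
      \<open>S\<close>. Through the centre \<open>g0\<close>,
      \<open>D c \<one> = D (g \<otimes> c) g\<close> is at most
      \<open>2 * (\<delta> / 3) < \<delta>\<close>, so \<open>c\<close> cannot lie in
      \<open>C - (V <#> H)\<close>. This is where the factor 3 in the radius comes from.\<close>
    have gap: "\<exists>v\<in>V. \<exists>h\<in>H. s = g \<otimes> v \<otimes> h" if "s \<in> S" "g \<in> S" "c \<in> C" "h \<in> H" "s = g \<otimes> c \<otimes> h" for s g c h
    proof -
      have G: "g \<in> carrier G" "c \<in> carrier G" "h \<in> carrier G"
        using that CG H.subset by (auto simp: S_def)
      have "s \<otimes> inv h = g \<otimes> c"
        using that G by (simp add: m_assoc)
      then have "g \<otimes> c \<in> S"
        using S_H[of s "inv h"] that by simp
      then have "D c \<one> \<le> D (g \<otimes> c) g0 + D g0 g"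
        using D_left[of g c \<one>] D_tri[of "g \<otimes> c" g0 g] G g0 by simp
      also have "\<dots> \<le> 2 * (\<delta> / 3)"
        using \<open>g \<otimes> c \<in> S\<close> \<open>g \<in> S\<close> D_sym[of g0 g] by (simp add: S_def)
      finally have "c \<in> V <#> H"
        using \<delta> that(3) by force
      then obtain v k where "v \<in> V" "k \<in> H" "c = v \<otimes> k"
        by (auto simp: set_mult_def)
      moreover have "v \<in> carrier G" "k \<in> carrier G"
        using calculation VG H.subset by auto
      ultimately show ?thesis
        using that(4,5) G by (metis H.m_closed m_assoc m_closed)
    qed
    have tr_open: "openin T (tr V g)" if "g \<in> carrier G" for g
      using openin_left_translation[OF that V(1)] by (simp add: tr_def)
    have tr_compact: "compactin T (tr C g)" if "g \<in> carrier G" for g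
      using image_compactin[OF C continuous_map_left_translation[OF that]] by (simp add: tr_def)
    have "S \<subseteq> topspace T"
      by (auto simp: S_def carrier_eq)
    moreover have "s \<in> tr V s" if "s \<in> S" for s
      using V(2) that by (force simp: tr_def S_def)
    \<comment> \<open>The translates are centred at points of \<open>S\<close> itself, because
      \<open>gap\<close> requires \<open>g \<in> S\<close>; the Lindelof property then leaves
      countably many.\<close>
    ultimately have "\<Union>((\<lambda>g. S \<inter> tr V g) ` S) = topspace (subtopology T S)"
      by auto
    moreover have "openin (subtopology T S) U" if "U \<in> (\<lambda>g. S \<inter> tr V g) ` S" for U
      using that tr_open by (auto simp: S_def openin_subtopology_Int2)
    moreover have "Lindelof_space (subtopology T S)"
      using second_countable second_countable_imp_Lindelof_space second_countable_subtopology by blast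
    ultimately obtain \<V> where "countable \<V>" "\<V> \<subseteq> (\<lambda>g. S \<inter> tr V g) ` S"
        "\<Union>\<V> = topspace (subtopology T S)"
      using Lindelof_spaceD by meson
    moreover from this obtain F where "countable F" "F \<subseteq> S" "\<V> = (\<lambda>g. S \<inter> tr V g) ` F"
      using countable_subset_image by metis
    ultimately have F: "countable F" "F \<subseteq> S" "S \<subseteq> (\<Union>g\<in>F. tr V g)"
      using \<open>S \<subseteq> topspace T\<close> by auto
    \<comment> \<open>Indexing by a set of naturals covers finite and infinite \<open>F\<close>
      alike and supplies the order used to make the pieces disjoint.\<close>
    obtain a :: "nat \<Rightarrow> 'g" and \<Lambda> where "bij_betw a \<Lambda> F"
      using countableE_bij[OF F(1)] by metis
    then have aS: "a i \<in> S" "a i \<in> carrier G" if "i \<in> \<Lambda>" for i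
      using F(2) that by (auto simp: bij_betw_def S_def)
    have cover_S: "\<exists>i\<in>\<Lambda>. s \<in> tr V (a i)" if "s \<in> S" for s
      using F(3) that \<open>bij_betw a \<Lambda> F\<close> by (auto simp: bij_betw_def)
    define W where "W i = tr V (a i) <#> H" for i
    have W_open: "openin T (W i)" if "i \<in> \<Lambda>" for i
      unfolding W_def using openin_set_mult tr_open aS[OF that] H.subset by blast
    have W_iff: "x \<in> W i \<longleftrightarrow> (\<exists>v\<in>V. \<exists>h\<in>H. x = a i \<otimes> v \<otimes> h)" for x i
      by (auto simp: W_def tr_def set_mult_def)
    have W_H: "x \<otimes> h \<in> W i" if x: "x \<in> W i" and h: "h \<in> H" and "i \<in> \<Lambda>" for x h i
    proof -
      obtain v k where vk: "v \<in> V" "k \<in> H" "x = a i \<otimes> v \<otimes> k"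
        using x W_iff by blast
      then have "x \<otimes> h = a i \<otimes> v \<otimes> (k \<otimes> h)"
        using aS[OF \<open>i \<in> \<Lambda>\<close>] VG H.subset h by (simp add: m_assoc subset_iff)
      then show ?thesis
        using vk h W_iff H.m_closed by metis
    qed
    \<comment> \<open>The removed sets are the saturated \<open>W j\<close>, not just
      \<open>tr V (a j)\<close>, since disjointness is needed for cosets. They are open, so
      \<open>Q i\<close> is a closed part of the compact \<open>tr C (a i)\<close>.\<close>
    define Q where "Q i = (S \<inter> (topspace T - (\<Union>j\<in>{j\<in>\<Lambda>. j < i}. W j))) \<inter> tr C (a i)" for i
    have Q_carrier: "x \<in> carrier G" if "x \<in> Q i" for x i
      using that by (simp add: Q_def carrier_eq)
    have "S = {x \<in> topspace T. D x g0 \<in> {..\<delta> / 3}}"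
      by (auto simp: S_def carrier_eq)
    then have "closedin T S"
      using closedin_continuous_map_preimage[OF D_cont[OF g0], of "{..\<delta> / 3}"] by simp
    moreover have "openin T (\<Union>j\<in>{j\<in>\<Lambda>. j < i}. W j)" for i
      using W_open by auto
    ultimately have Q_compact: "compactin T (Q i)" if "i \<in> \<Lambda>" for i
      unfolding Q_def using tr_compact aS[OF that]
      by (intro closed_Int_compactin closedin_Int closedin_diff closedin_topspace) auto
    define K where "K i = (\<lambda>g. g <# H) ` Q i" for i
    \<comment> \<open>A common coset would give \<open>x = a j \<otimes> c \<otimes> h\<close> in
      \<open>S\<close> with \<open>c \<in> C\<close>; then \<open>gap\<close> puts \<open>x\<close>
      into \<open>W j\<close>, which was removed from \<open>Q i\<close>.\<close>
    have "K i \<inter> K j = {}" if "i \<in> \<Lambda>" "j \<in> \<Lambda>" "j < i" for i j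
    proof (rule ccontr)
      assume "K i \<inter> K j \<noteq> {}"
      then obtain x y where xy: "x \<in> Q i" "y \<in> Q j" "x <# H = y <# H"
        by (auto simp: K_def)
      then have "x \<in> y <# H"
        using lcos_self[OF Q_carrier H] by blast
      then obtain h where "h \<in> H" "x = y \<otimes> h"
        by (auto simp: l_coset_def)
      moreover obtain c where "c \<in> C" "y = a j \<otimes> c"
        using xy(2) by (auto simp: Q_def tr_def)
      moreover have "x \<in> S"
        using xy(1) by (simp add: Q_def)
      ultimately have "x \<in> W j"
        using gap aS(1)[OF that(2)] W_iff by metis
      then show False
        using xy(1) that by (auto simp: Q_def)
    qed
    then have "disjoint_family_on K \<Lambda>"
      unfolding disjoint_family_on_def by (metis Int_commute linorder_neqE_nat)
    moreover have "K i \<subseteq> lcosets H" "compactin (coset_topology G T H) (K i)" if "i \<in> \<Lambda>" for i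
    proof -
      show "K i \<subseteq> lcosets H"
        using Q_carrier by (auto simp: K_def LCOSETS_def)
      show "compactin (coset_topology G T H) (K i)"
        unfolding K_def using Q_compact[OF that] quotient_map_coset_topology[OF carrier_eq]
        by (intro image_compactin quotient_imp_continuous_map)
    qed
    moreover have "k <# H \<in> (\<Union>i\<in>\<Lambda>. K i)" if k: "k \<in> carrier G" "D k g0 \<le> \<delta> / 3" for k
    proof -
      have "k \<in> S" using k by (simp add: S_def)
      have ex: "\<exists>i. i \<in> \<Lambda> \<and> k \<in> W i"
      proof -
        obtain i v where "i \<in> \<Lambda>" "v \<in> V" "k = a i \<otimes> v"
          using cover_S[OF \<open>k \<in> S\<close>] by (auto simp: tr_def)
        then have "k = a i \<otimes> v \<otimes> \<one>"
          using k(1) by simp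
        then show ?thesis
          using \<open>i \<in> \<Lambda>\<close> \<open>v \<in> V\<close> H.one_closed W_iff by blast
      qed
      \<comment> \<open>The least index whose saturated translate contains \<open>k\<close>, so that
        \<open>k\<close> avoids everything removed from \<open>Q i\<close>.\<close>
      obtain i where i: "i \<in> \<Lambda>" "k \<in> W i" "\<And>j. j \<in> \<Lambda> \<Longrightarrow> j < i \<Longrightarrow> k \<notin> W j"
        using LeastI_ex[OF ex] not_less_Least by blast
      obtain v h where vh: "v \<in> V" "h \<in> H" "k = a i \<otimes> v \<otimes> h"
        using i(2) W_iff by blast
      \<comment> \<open>\<open>k\<close> itself may lie outside \<open>tr C (a i)\<close>, so it is
        replaced by this representative of the same coset. Membership in \<open>S\<close> and
        avoidance of the earlier \<open>W j\<close> carry over, both being unaffected by right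
        multiplication by \<open>H\<close>.\<close>
      define x where "x = a i \<otimes> v"
      have x: "x \<in> carrier G" "k = x \<otimes> h" "h \<in> carrier G"
        using aS[OF i(1)] vh VG H.subset by (auto simp: x_def)
      have "x = k \<otimes> inv h"
        using x by (simp add: m_assoc)
      then have "x \<in> S"
        using S_H[OF \<open>k \<in> S\<close>, of "inv h"] vh(2) by simp
      moreover have "x \<in> tr C (a i)"
        using vh(1) \<open>V \<subseteq> C\<close> by (auto simp: x_def tr_def)
      moreover have "x \<notin> W j" if "j \<in> \<Lambda>" "j < i" for j
        using W_H[OF _ vh(2) that(1), of x] i(3)[OF that] x(2) by blast
      ultimately have "x \<in> Q i"
        using x(1) by (auto simp: Q_def carrier_eq)
      moreover have "k \<in> x <# H"
        using x(2) vh(2) by (auto simp: l_coset_def)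
      then have "k <# H = x <# H"
        using l_repr_independence[OF _ x(1) H] by blast
      ultimately show ?thesis
        using i(1) by (auto simp: K_def)
    qed
    ultimately show "\<exists>(\<Lambda> :: nat set) K. disjoint_family_on K \<Lambda> \<and>
       (\<forall>i\<in>\<Lambda>. K i \<subseteq> lcosets H \<and> compactin (coset_topology G T H) (K i)) \<and>
       (\<lambda>k. k <# H) ` {k \<in> carrier G. D k g0 \<le> \<delta> / 3} \<subseteq> (\<Union>i\<in>\<Lambda>. K i)"
      by blast
  qed
qed

section \<open>Application to the induced Hausdorff metric\<close>

theorem theorem5p3:
  fixes G :: "('g, 'r) monoid_scheme" and m :: nat and TG :: "'g topology" and AG :: "'g chart set"
    and n :: nat and TM :: "'a topology" and AM :: "'a chart set"
    and d :: "'a \<Rightarrow> 'a \<Rightarrow> real" and X :: "'a set" and \<Phi> :: "'g \<Rightarrow> 'a \<Rightarrow> 'a"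
  assumes "lie_group G m TG AG"
    and "smooth_manifold n TM AM"
    and "Metric_space (topspace TM) d"
    and "Metric_space.mtopology (topspace TM) d = TM"
    and "X \<noteq> {}" and "compactin TM X"
    and "group_action G (topspace TM) \<Phi>"
    and "smooth_map (m + n) (prod_topology TG TM) (prod_atlas m AG AM) n TM AM (\<lambda>(g, x). \<Phi> g x)"
    and "\<And>g x y. \<lbrakk>g \<in> carrier G; x \<in> topspace TM; y \<in> topspace TM\<rbrakk> \<Longrightarrow> d (\<Phi> g x) (\<Phi> g y) = d x y"
  shows "\<exists>\<epsilon>>0. \<forall>g\<in>carrier G. \<exists>(\<Lambda> :: nat set) K.
           disjoint_family_on K \<Lambda> \<and>
           (\<forall>i\<in>\<Lambda>. K i \<subseteq> lcosets\<^bsub>G\<^esub> (isotropy G \<Phi> X) \<and>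
                  compactin (coset_topology G TG (isotropy G \<Phi> X)) (K i)) \<and>
           {p \<in> lcosets\<^bsub>G\<^esub> (isotropy G \<Phi> X).
              induced_dist d \<Phi> X p (g <#\<^bsub>G\<^esub> isotropy G \<Phi> X) < \<epsilon>} \<subseteq> (\<Union>i\<in>\<Lambda>. K i)"
proof -
  interpret G: lie_group G m TG AG by fact
  interpret d: Metric_space "topspace TM" d by fact
  interpret act: group_action G "topspace TM" \<Phi> by fact
  have top: "d.mtopology = TM" by fact
  note iso = assms(9)
  have X: "compactin d.mtopology X" "X \<noteq> {}"
    using assms(5,6) top by simp_all
  have XM: "X \<subseteq> topspace TM"
    using assms(6) compactin_subset_topspace by blast
  define H where "H = isotropy G \<Phi> X"
  define D where "D g h = hausdorff_dist d (\<Phi> g ` X) (\<Phi> h ` X)" for g h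
  have cont: "continuous_map (prod_topology TG d.mtopology) d.mtopology (\<lambda>(g, x). \<Phi> g x)"
    using assms(8) by (simp add: smooth_map_def top)
  have cpt: "compactin d.mtopology (\<Phi> g ` X)" "\<Phi> g ` X \<noteq> {}" if "g \<in> carrier G" for g
  proof -
    have "continuous_map d.mtopology d.mtopology (\<Phi> g)"
      using continuous_map_compose[OF _ cont, of d.mtopology "\<lambda>x. (g, x)"] that
      by (auto simp: o_def continuous_map_pairwise G.carrier_eq)
    then show "compactin d.mtopology (\<Phi> g ` X)" "\<Phi> g ` X \<noteq> {}"
      using image_compactin[OF X(1)] X(2) by auto
  qed
  have one: "\<Phi> \<one>\<^bsub>G\<^esub> ` X = X"
    using XM by (force simp: act.id_eq_one[symmetric])
  have H: "subgroup H G"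
    unfolding H_def using act.subgroup_isotropy[OF XM] .
  obtain \<epsilon> where \<epsilon>: "\<epsilon> > 0"
    "\<And>g. g \<in> carrier G \<Longrightarrow> \<exists>(\<Lambda> :: nat set) K. disjoint_family_on K \<Lambda> \<and>
       (\<forall>i\<in>\<Lambda>. K i \<subseteq> lcosets\<^bsub>G\<^esub> H \<and> compactin (coset_topology G TG H) (K i)) \<and>
       (\<lambda>k. k <#\<^bsub>G\<^esub> H) ` {k \<in> carrier G. D k g \<le> \<epsilon>} \<subseteq> (\<Union>i\<in>\<Lambda>. K i)"
  proof (rule G.coset_balls_in_disjoint_compacts[OF H, of D])
    show "D g \<one>\<^bsub>G\<^esub> \<le> 0 \<longleftrightarrow> g \<in> H" if "g \<in> carrier G" for g
      using d.hausdorff_dist_le_0_iff[OF cpt[OF that] cpt[OF G.one_closed]] that one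
      by (simp add: D_def H_def isotropy_def)
    show "D g h = D h g" for g h
      by (simp add: D_def hausdorff_dist_def max.commute)
    show "D g k \<le> D g h + D h k" if "g \<in> carrier G" "h \<in> carrier G" "k \<in> carrier G" for g h k
      unfolding D_def using that by (intro d.hausdorff_dist_triangle cpt)
    show "D (g \<otimes>\<^bsub>G\<^esub> h) (g \<otimes>\<^bsub>G\<^esub> k) = D h k"
      if "g \<in> carrier G" "h \<in> carrier G" "k \<in> carrier G" for g h k
    proof -
      have "\<Phi> h ` X \<subseteq> topspace TM" "\<Phi> k ` X \<subseteq> topspace TM"
        using act.element_image that XM by blast+
      \<comment> \<open>Both argument orders are recorded because the two halves of
        \<open>hausdorff_dist\<close> use opposite ones.\<close>
      then have "d (\<Phi> g x) (\<Phi> g y) = d x y" "d (\<Phi> g y) (\<Phi> g x) = d y x"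
        if "x \<in> \<Phi> h ` X" "y \<in> \<Phi> k ` X" for x y
        using iso[OF \<open>g \<in> carrier G\<close>] that by blast+
      then show ?thesis
        unfolding D_def act.image_mult[OF \<open>g \<in> carrier G\<close> \<open>h \<in> carrier G\<close> XM]
          act.image_mult[OF \<open>g \<in> carrier G\<close> \<open>k \<in> carrier G\<close> XM] hausdorff_dist_def
        by (simp add: image_image)
    qed
    show "continuous_map TG euclideanreal (\<lambda>h. D h g)" if "g \<in> carrier G" for g
      unfolding D_def using d.continuous_map_hausdorff_dist[OF cont X cpt[OF that]] .
  qed (use that in blast)
  \<comment> \<open>Every point of the open ball is a coset of some \<open>k\<close>, and its
    induced distance is \<open>D k g\<close> by independence of representatives; the strict bound
    gives the non-strict one.\<close>
  have "{p \<in> lcosets\<^bsub>G\<^esub> H. induced_dist d \<Phi> X p (g <#\<^bsub>G\<^esub> H) < \<epsilon>}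
      \<subseteq> (\<lambda>k. k <#\<^bsub>G\<^esub> H) ` {k \<in> carrier G. D k g \<le> \<epsilon>}" if "g \<in> carrier G" for g
    using that act.induced_dist_lcoset[OF XM _ that, of _ d]
    by (fastforce simp: LCOSETS_def H_def D_def)
  then show ?thesis
    using \<epsilon> unfolding H_def by (meson subset_trans)
qed

end
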